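(* Let $\mathcal F=\{\langle\cdot,\cdot\rangle_i\}_{i\in I\cup\{0\}}$ be a nondegenerate family of inner products on a vector space $V$ over a field $\mathbb{K}$, where $\langle\cdot,\cdot\rangle_0$ is nondegenerate and every $\langle\cdot,\cdot\rangle_i$ is partially continuous relative to the $\langle\cdot,\cdot\rangle_0$-topology of $V$. Let $T_i\colon V\to V$ ($i\in I$) be the linear maps determined by $\langle x,y\rangle_i=\langle T_i(x),y\rangle_0$ for all $x,y\in V$. If $\mathcal F$ is simultaneously orthogonalizable, then $V$ is the direct sum of the root spaces $V_\alpha$, where $\alpha$ ranges over the roots of $\{T_i\}_{i\in I}$, and this sum is orthogonal relative to every inner product of $\mathcal F$. Moreover, for any $i$ and $\alpha$ we have $\langle\cdot,\cdot\rangle_i|_{V_\alpha}=c_{i,\alpha}\langle\cdot,\cdot\rangle_0|_{V_\alpha}$ for suitable $c_{i,\alpha}\in\mathbb{K}$, and each $\langle\cdot,\cdot\rangle_i$ can be represented in block diagonal form, where each block is the matrix of $c_{i,\alpha}\langle\cdot,\cdot\rangle_0|_{V_\alpha}$ relative to some basis of $V_\alpha$.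
   Context: An inner product on a $\mathbb{K}$-vector space $V$ is a symmetric bilinear form $\langle\cdot,\cdot\rangle\colon V\times V\to\mathbb{K}$; it is nondegenerate if its radical $\{x\in V\colon\langle x,V\rangle=0\}$ is $0$. For a nondegenerate inner product, the $\langle\cdot,\cdot\rangle$-topology of $V$ is the one in which a basis of neighborhoods of $x\in V$ is given by the sets $x+\bigcap_{k=1}^n v_k^\perp$, with $v_1,\dots,v_n$ a finite collection in $V$ and $v^\perp=\{x\in V\colon\langle x,v\rangle=0\}$. $\mathbb{K}$ carries the discrete topology. A map $B\colon X\times X\to Y$ is partially continuous if $B(x,\_)$ and $B(\_,x)$ are continuous for every $x\in X$. A family of inner products is nondegenerate if it contains an element $\langle\cdot,\cdot\rangle_0$ with zero radical such that every element of the family is partially continuous relative to the $\langle\cdot,\cdot\rangle_0$-topology. In that case maps $T_i$ with $\langle x,y\rangle_i=\langle T_i(x),y\rangle_0$ exist and are unique. A family $\{\langle\cdot,\cdot\rangle_i\}$ is simultaneously orthogonalizable if there is a basis $\{v_j\}$ of $V$ with $\langle v_j,v_k\rangle_i=0$ for all $i$ and all $j\neq k$. A root of $\mathcal T\subset\mathrm{End}(V)$ is a map $\alpha\colon\mathcal T\to\mathbb{K}$ for which there is a nonzero $v\in V$ with $T(v)=\alpha(T)v$ for all $T\in\mathcal T$; its root space is $V_\alpha=\{w\in V\colon T(w)=\alpha(T)w\ \forall T\in\mathcal T\}$. *)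

theory Defs
  imports "HOL-Analysis.Abstract_Topology" "HOL-Library.Disjoint_Sets"
begin

text \<open>Vector spaces are the whole type \<open>'v\<close> with scalar multiplication
  \<open>scale\<close> over the field \<open>'k\<close>, as in \<^locale>\<open>vector_space\<close>.\<close>

definition inner_product ::
  "('k::field \<Rightarrow> 'v::ab_group_add \<Rightarrow> 'v) \<Rightarrow> ('v \<Rightarrow> 'v \<Rightarrow> 'k) \<Rightarrow> bool" where
  "inner_product scale B \<longleftrightarrow>
     (\<forall>x y. B x y = B y x) \<and>
     (\<forall>x. Vector_Spaces.linear scale (*) (B x)) \<and>
     (\<forall>y. Vector_Spaces.linear scale (*) (\<lambda>x. B x y))"

definition form_radical :: "('v \<Rightarrow> 'v \<Rightarrow> 'k::zero) \<Rightarrow> 'v set" where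
  "form_radical B = {x. \<forall>y. B x y = 0}"

definition nondegenerate :: "('v::zero \<Rightarrow> 'v \<Rightarrow> 'k::zero) \<Rightarrow> bool" where
  "nondegenerate B \<longleftrightarrow> form_radical B = {0}"

definition perp :: "('v \<Rightarrow> 'v \<Rightarrow> 'k::zero) \<Rightarrow> 'v \<Rightarrow> 'v set" where
  "perp B v = {x. B x v = 0}"

definition form_topology :: "('v::ab_group_add \<Rightarrow> 'v \<Rightarrow> 'k::zero) \<Rightarrow> 'v topology" where
  "form_topology B =
     topology (\<lambda>U. \<forall>x\<in>U. \<exists>F. finite F \<and> (+) x ` (\<Inter>v\<in>F. perp B v) \<subseteq> U)"

lemma openin_form_topology:
  "openin (form_topology B) U \<longleftrightarrow>
     (\<forall>x\<in>U. \<exists>F. finite F \<and> (+) x ` (\<Inter>v\<in>F. perp B v) \<subseteq> U)"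
proof -
  have "istopology (\<lambda>U. \<forall>x\<in>U. \<exists>F. finite F \<and> (+) x ` (\<Inter>v\<in>F. perp B v) \<subseteq> U)"
    unfolding istopology_def
  proof (intro conjI allI impI ballI)
    fix S T x
    assume S: "\<forall>x\<in>S. \<exists>F. finite F \<and> (+) x ` (\<Inter>v\<in>F. perp B v) \<subseteq> S"
      and T: "\<forall>x\<in>T. \<exists>F. finite F \<and> (+) x ` (\<Inter>v\<in>F. perp B v) \<subseteq> T"
      and x: "x \<in> S \<inter> T"
    from S x obtain F where F: "finite F" "(+) x ` (\<Inter>v\<in>F. perp B v) \<subseteq> S" by (meson IntD1)
    from T x obtain G where G: "finite G" "(+) x ` (\<Inter>v\<in>G. perp B v) \<subseteq> T" by (meson IntD2)
    have "(+) x ` (\<Inter>v\<in>F \<union> G. perp B v) \<subseteq> S \<inter> T"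
      using F(2) G(2) by (auto simp: image_subset_iff)
    with F(1) G(1) show "\<exists>F. finite F \<and> (+) x ` (\<Inter>v\<in>F. perp B v) \<subseteq> S \<inter> T"
      by (intro exI[of _ "F \<union> G"] conjI) simp_all
  next
    fix K x
    assume K: "\<forall>U\<in>K. \<forall>x\<in>U. \<exists>F. finite F \<and> (+) x ` (\<Inter>v\<in>F. perp B v) \<subseteq> U"
      and x: "x \<in> \<Union>K"
    from x obtain U where U: "U \<in> K" "x \<in> U" by blast
    with K obtain F where "finite F" "(+) x ` (\<Inter>v\<in>F. perp B v) \<subseteq> U" by meson
    moreover have "U \<subseteq> \<Union>K" using U(1) by blast
    ultimately show "\<exists>F. finite F \<and> (+) x ` (\<Inter>v\<in>F. perp B v) \<subseteq> \<Union>K"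
      by (meson order_trans)
  qed
  then show ?thesis by (simp only: form_topology_def topology_inverse')
qed

lemma topspace_form_topology [simp]: "topspace (form_topology B) = UNIV"
proof -
  have "openin (form_topology B) UNIV"
    unfolding openin_form_topology by (meson finite.emptyI subset_UNIV)
  then show ?thesis by (simp add: openin_subset top.extremum_uniqueI)
qed

definition partially_continuous ::
  "'x topology \<Rightarrow> 'y topology \<Rightarrow> ('x \<Rightarrow> 'x \<Rightarrow> 'y) \<Rightarrow> bool" where
  "partially_continuous X Y B \<longleftrightarrow>
     (\<forall>x\<in>topspace X. continuous_map X Y (B x) \<and> continuous_map X Y (\<lambda>y. B y x))"

definition associated_map ::
  "('k::field \<Rightarrow> 'v::ab_group_add \<Rightarrow> 'v) \<Rightarrow> ('v \<Rightarrow> 'v \<Rightarrow> 'k) \<Rightarrow> ('v \<Rightarrow> 'v \<Rightarrow> 'k) \<Rightarrow> 'v \<Rightarrow> 'v" where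
  "associated_map scale B\<^sub>0 B =
     (THE T. Vector_Spaces.linear scale scale T \<and> (\<forall>x y. B x y = B\<^sub>0 (T x) y))"

lemma functional_representation:
  fixes scale :: "'k::field \<Rightarrow> 'v::ab_group_add \<Rightarrow> 'v"
  assumes B: "inner_product scale B"
    and "finite F" and "Vector_Spaces.linear scale (*) f"
    and "\<And>y. (\<forall>v\<in>F. B v y = 0) \<Longrightarrow> f y = 0"
  shows "\<exists>u. \<forall>y. f y = B u y"
  using assms(2-)
proof (induction F arbitrary: f rule: finite_induct)
  case empty
  interpret l: Vector_Spaces.linear scale "(*)" "\<lambda>x. B x y" for y
    using B by (simp add: inner_product_def)
  show ?case using empty by (intro exI[of _ 0]) (simp add: l.zero)
next
  case (insert v F)
  interpret l: Vector_Spaces.linear scale "(*)" "\<lambda>x. B x y" for y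
    using B by (simp add: inner_product_def)
  interpret r: Vector_Spaces.linear scale "(*)" "B x" for x
    using B by (simp add: inner_product_def)
  interpret f: Vector_Spaces.linear scale "(*)" f by fact
  show ?case
  proof (cases "\<exists>y0. (\<forall>w\<in>F. B w y0 = 0) \<and> B v y0 \<noteq> 0")
    case False
    then have "f y = 0" if "\<forall>w\<in>F. B w y = 0" for y
      using that insert.prems(2)[of y] False by auto
    then show ?thesis by (intro insert.IH insert.prems(1)) blast
  next
    case True
    then obtain y0 where y0: "\<forall>w\<in>F. B w y0 = 0" "B v y0 \<noteq> 0" by blast
    define c where "c = f y0 / B v y0"
    have "Vector_Spaces.linear scale (*) (\<lambda>y. f y - c * B v y)"
    proof unfold_locales
      show "f (y + y') - c * B v (y + y') = (f y - c * B v y) + (f y' - c * B v y')" for y y'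
        by (simp only: f.add r.add distrib_left add_diff_add)
      show "f (scale a y) - c * B v (scale a y) = a * (f y - c * B v y)" for a y
        by (simp only: f.scale r.scale right_diff_distrib mult.left_commute)
    qed
    moreover have "f y - c * B v y = 0" if y: "\<forall>w\<in>F. B w y = 0" for y
    proof -
      define d where "d = B v y / B v y0"
      have "f (y - scale d y0) = 0"
      proof (rule insert.prems(2), rule ballI)
        fix w assume "w \<in> insert v F"
        then show "B w (y - scale d y0) = 0"
          using y y0 by (auto simp: r.diff r.scale d_def)
      qed
      then have "f y = d * f y0" by (simp add: f.diff f.scale)
      then show ?thesis by (simp add: d_def c_def)
    qed
    ultimately have "\<exists>u. \<forall>y. f y - c * B v y = B u y"
      by (rule insert.IH)
    then obtain u where u: "f y - c * B v y = B u y" for y by blast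
    have "f y = B (u + scale c v) y" for y
      using u[of y] by (simp add: l.add l.scale diff_eq_eq)
    then show ?thesis by blast
  qed
qed

lemma associated_map_ex1:
  fixes scale :: "'k::field \<Rightarrow> 'v::ab_group_add \<Rightarrow> 'v"
  assumes B0: "inner_product scale B\<^sub>0" "nondegenerate B\<^sub>0"
    and B: "inner_product scale B"
    and cont: "partially_continuous (form_topology B\<^sub>0) (discrete_topology UNIV) B"
  shows "\<exists>!T. Vector_Spaces.linear scale scale T \<and> (\<forall>x y. B x y = B\<^sub>0 (T x) y)"
proof -
  interpret l: Vector_Spaces.linear scale "(*)" "\<lambda>x. B x y" for y
    using B by (simp add: inner_product_def)
  interpret r: Vector_Spaces.linear scale "(*)" "B x" for x
    using B by (simp add: inner_product_def)
  interpret l0: Vector_Spaces.linear scale "(*)" "\<lambda>x. B\<^sub>0 x y" for y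
    using B0 by (simp add: inner_product_def)
  have inj: "x = x'" if "\<And>y. B\<^sub>0 x y = B\<^sub>0 x' y" for x x'
  proof -
    have "x - x' \<in> form_radical B\<^sub>0"
      using that by (simp add: form_radical_def l0.diff)
    then show ?thesis using B0(2) by (simp add: nondegenerate_def)
  qed
  have "\<exists>u. \<forall>y. B x y = B\<^sub>0 u y" for x
  proof -
    have "continuous_map (form_topology B\<^sub>0) (discrete_topology UNIV) (B x)"
      using cont by (simp add: partially_continuous_def)
    then have "openin (form_topology B\<^sub>0) {y. B x y \<in> {0}}"
      using openin_continuous_map_preimage[of _ _ "B x" "{0}"] by fastforce
    moreover have "0 \<in> {y. B x y \<in> {0}}" by (simp add: r.zero)
    ultimately obtain F where F: "finite F" "(+) 0 ` (\<Inter>v\<in>F. perp B\<^sub>0 v) \<subseteq> {y. B x y \<in> {0}}"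
      unfolding openin_form_topology by meson
    have "\<forall>x y. B\<^sub>0 x y = B\<^sub>0 y x" using B0 by (simp add: inner_product_def)
    then have "B x y = 0" if "\<forall>v\<in>F. B\<^sub>0 v y = 0" for y
      using F(2) that by (simp add: perp_def subset_iff)
    with functional_representation[OF B0(1) F(1), of "B x"] B show ?thesis
      by (simp add: inner_product_def)
  qed
  then obtain T where T: "\<And>x y. B x y = B\<^sub>0 (T x) y" by metis
  have "Vector_Spaces.linear scale scale T"
  proof unfold_locales
    show "T (x + x') = T x + T x'" for x x'
      by (rule inj) (simp only: T[symmetric] l.add l0.add)
    show "T (scale a x) = scale a (T x)" for a x
      by (rule inj) (simp only: T[symmetric] l.scale l0.scale)
  qed
  moreover have "T' = T" if "\<forall>x y. B x y = B\<^sub>0 (T' x) y" for T'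
  proof
    show "T' x = T x" for x
      by (rule inj) (metis T that)
  qed
  ultimately show ?thesis using T by blast
qed

definition basis_of ::
  "('k::field \<Rightarrow> 'v::ab_group_add \<Rightarrow> 'v) \<Rightarrow> 'v set \<Rightarrow> 'v set \<Rightarrow> bool" where
  "basis_of scale W E \<longleftrightarrow> \<not> module.dependent scale E \<and> module.span scale E = W"

definition simultaneously_orthogonalizable ::
  "('k::field \<Rightarrow> 'v::ab_group_add \<Rightarrow> 'v) \<Rightarrow> 'i set \<Rightarrow> ('i \<Rightarrow> 'v \<Rightarrow> 'v \<Rightarrow> 'k) \<Rightarrow> bool" where
  "simultaneously_orthogonalizable scale J B \<longleftrightarrow>
     (\<exists>E. basis_of scale UNIV E \<and> (\<forall>i\<in>J. \<forall>u\<in>E. \<forall>v\<in>E. u \<noteq> v \<longrightarrow> B i u v = 0))"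

text \<open>A root is a function on \<open>\<T>\<close> only; extensionality outside \<open>\<T>\<close> makes distinct
  elements of \<open>roots scale \<T>\<close> distinct maps on \<open>\<T>\<close>.\<close>

definition roots ::
  "('k::field \<Rightarrow> 'v::ab_group_add \<Rightarrow> 'v) \<Rightarrow> ('v \<Rightarrow> 'v) set \<Rightarrow> (('v \<Rightarrow> 'v) \<Rightarrow> 'k) set" where
  "roots scale \<T> = {\<alpha> \<in> \<T> \<rightarrow>\<^sub>E UNIV. \<exists>v. v \<noteq> 0 \<and> (\<forall>T\<in>\<T>. T v = scale (\<alpha> T) v)}"

definition root_space ::
  "('k::field \<Rightarrow> 'v::ab_group_add \<Rightarrow> 'v) \<Rightarrow> ('v \<Rightarrow> 'v) set \<Rightarrow> (('v \<Rightarrow> 'v) \<Rightarrow> 'k) \<Rightarrow> 'v set" where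
  "root_space scale \<T> \<alpha> = {w. \<forall>T\<in>\<T>. T w = scale (\<alpha> T) w}"

definition is_direct_sum ::
  "('k::field \<Rightarrow> 'v::ab_group_add \<Rightarrow> 'v) \<Rightarrow> 'a set \<Rightarrow> ('a \<Rightarrow> 'v set) \<Rightarrow> bool" where
  "is_direct_sum scale A W \<longleftrightarrow>
     (\<forall>a\<in>A. module.subspace scale (W a)) \<and>
     (\<forall>x. \<exists>!f. (\<forall>a\<in>A. f a \<in> W a) \<and> (\<forall>a. a \<notin> A \<longrightarrow> f a = 0) \<and>
               finite {a. f a \<noteq> 0} \<and> x = (\<Sum>a | f a \<noteq> 0. f a))"

text \<open>Matrices, possibly infinite, have their rows and columns indexed by the
  vectors of a basis.\<close>

definition gram_matrix :: "'v set \<Rightarrow> ('v \<Rightarrow> 'v \<Rightarrow> 'k) \<Rightarrow> 'v \<Rightarrow> 'v \<Rightarrow> 'k" where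
  "gram_matrix E B = (\<lambda>u\<in>E. \<lambda>v\<in>E. B u v)"

definition block_diagonal ::
  "'a set \<Rightarrow> ('a \<Rightarrow> 'v set) \<Rightarrow> ('v \<Rightarrow> 'v \<Rightarrow> 'k::zero) \<Rightarrow> ('a \<Rightarrow> 'v \<Rightarrow> 'v \<Rightarrow> 'k) \<Rightarrow> bool" where
  "block_diagonal A E M N \<longleftrightarrow>
     disjoint_family_on E A \<and>
     (\<forall>a\<in>A. \<forall>b\<in>A. \<forall>u\<in>E a. \<forall>v\<in>E b. M u v = (if a = b then N a u v else 0))"

end

theory Submission
  imports Defs
begin

text \<open>
  The vectors of a simultaneously orthogonal basis \<open>b\<close> are common eigenvectors of the maps
  \<open>T\<^sub>i\<close>. For \<open>e \<in> b\<close>, nondegeneracy forces \<open>\<langle>e,e\<rangle>\<^sub>0 \<noteq> 0\<close>, since otherwise \<open>e\<close> would be orthogonal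
  to the whole basis and lie in the radical. With \<open>r = \<langle>e,e\<rangle>\<^sub>i / \<langle>e,e\<rangle>\<^sub>0\<close> the vectors \<open>T\<^sub>i e\<close> and
  \<open>r e\<close> then have the same \<open>\<langle>\<cdot>,\<cdot>\<rangle>\<^sub>0\<close>-product with every basis vector, hence coincide
  (lemma \<open>orthogonal_basis_eigenvector\<close>).

  The rest splits in two. Linear algebra: if a basis consists of common eigenvectors, then each
  root space is spanned by the basis vectors that it contains
  (lemma \<open>root_space_eq_span\<close>), so the roots partition the basis and a partition of a basis gives
  a direct sum (lemma \<open>direct_sum_of_basis_partition\<close>). Forms: symmetry of \<open>\<langle>\<cdot>,\<cdot>\<rangle>\<^sub>i\<close> makes \<open>T\<^sub>i\<close>
  self-adjoint, so distinct root spaces are orthogonal, and on \<open>V\<^sub>\<alpha>\<close> the identity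
  \<open>\<langle>x,y\<rangle>\<^sub>i = \<langle>T\<^sub>i x,y\<rangle>\<^sub>0\<close> reads \<open>\<langle>x,y\<rangle>\<^sub>i = \<alpha>(T\<^sub>i)\<langle>x,y\<rangle>\<^sub>0\<close>. The blocks come from cutting \<open>b\<close> along the
  root spaces.
\<close>

section \<open>Inner products and their associated maps\<close>

lemma inner_product_commute:
  "inner_product scale B \<Longrightarrow> B x y = B y x"
  by (simp add: inner_product_def)

lemma nondegenerate_cancel:
  fixes scale :: "'k::field \<Rightarrow> 'v::ab_group_add \<Rightarrow> 'v"
  assumes "inner_product scale B" "nondegenerate B" and eq: "\<And>y. B x y = B x' y"
  shows "x = x'"
proof -
  interpret l: Vector_Spaces.linear scale "(*)" "\<lambda>x. B x y" for y
    using assms(1) by (simp add: inner_product_def)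
  have "x - x' \<in> form_radical B"
    using eq by (simp add: form_radical_def l.diff)
  then show ?thesis using assms(2) by (simp add: nondegenerate_def)
qed

lemma associated_map_properties:
  fixes scale :: "'k::field \<Rightarrow> 'v::ab_group_add \<Rightarrow> 'v"
  assumes "inner_product scale B\<^sub>0" "nondegenerate B\<^sub>0" "inner_product scale B"
    and "partially_continuous (form_topology B\<^sub>0) (discrete_topology UNIV) B"
  shows "Vector_Spaces.linear scale scale (associated_map scale B\<^sub>0 B)"
    and "B x y = B\<^sub>0 (associated_map scale B\<^sub>0 B x) y"
  using theI'[OF associated_map_ex1[OF assms], folded associated_map_def] by blast+

context vector_space
begin

section \<open>Root spaces and bases of common eigenvectors\<close>

lemma subspace_root_space:
  assumes "\<And>T. T \<in> \<T> \<Longrightarrow> Vector_Spaces.linear scale scale T"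
  shows "subspace (root_space scale \<T> \<alpha>)"
proof (rule subspaceI)
  show "0 \<in> root_space scale \<T> \<alpha>"
  proof -
    have "T 0 = 0" if "T \<in> \<T>" for T
    proof -
      interpret T: Vector_Spaces.linear scale scale T by (rule assms[OF that])
      show ?thesis by (rule T.zero)
    qed
    then show ?thesis by (simp add: root_space_def)
  qed
next
  fix x y assume xy: "x \<in> root_space scale \<T> \<alpha>" "y \<in> root_space scale \<T> \<alpha>"
  have "T (x + y) = scale (\<alpha> T) (x + y)" if "T \<in> \<T>" for T
  proof -
    interpret T: Vector_Spaces.linear scale scale T by (rule assms[OF that])
    show ?thesis using xy that by (simp add: root_space_def T.add scale_right_distrib)
  qed
  then show "x + y \<in> root_space scale \<T> \<alpha>" by (simp add: root_space_def)
next
  fix c x assume x: "x \<in> root_space scale \<T> \<alpha>"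
  have "T (scale c x) = scale (\<alpha> T) (scale c x)" if "T \<in> \<T>" for T
  proof -
    interpret T: Vector_Spaces.linear scale scale T by (rule assms[OF that])
    have "T x = scale (\<alpha> T) x" using x that by (simp add: root_space_def)
    then show ?thesis by (simp add: T.scale mult.commute)
  qed
  then show "scale c x \<in> root_space scale \<T> \<alpha>" by (simp add: root_space_def)
qed

lemma root_eq_of_common_eigenvector:
  assumes "\<alpha> \<in> roots scale \<T>" "\<beta> \<in> roots scale \<T>"
    and "x \<in> root_space scale \<T> \<alpha>" "x \<in> root_space scale \<T> \<beta>" "x \<noteq> 0"
  shows "\<alpha> = \<beta>"
proof (rule PiE_ext)
  show "\<alpha> \<in> \<T> \<rightarrow>\<^sub>E UNIV" "\<beta> \<in> \<T> \<rightarrow>\<^sub>E UNIV" using assms by (auto simp: roots_def)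
  show "\<alpha> T = \<beta> T" if "T \<in> \<T>" for T
  proof -
    have "scale (\<alpha> T) x = scale (\<beta> T) x" using assms that by (simp add: root_space_def)
    then show ?thesis using \<open>x \<noteq> 0\<close> by simp
  qed
qed

lemma common_eigenvector_in_root_space:
  assumes "x \<noteq> 0" and "\<And>T. T \<in> \<T> \<Longrightarrow> \<exists>r. T x = scale r x"
  shows "\<exists>\<alpha>\<in>roots scale \<T>. x \<in> root_space scale \<T> \<alpha>"
proof -
  obtain r where r: "\<And>T. T \<in> \<T> \<Longrightarrow> T x = scale (r T) x" using assms(2) by metis
  have "restrict r \<T> \<in> roots scale \<T>" using r \<open>x \<noteq> 0\<close> by (auto simp: roots_def)
  moreover have "x \<in> root_space scale \<T> (restrict r \<T>)" using r by (simp add: root_space_def)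
  ultimately show ?thesis by blast
qed

text \<open>Comparing coordinates in \<open>T x = \<alpha>(T) x\<close> shows that the eigenvalue of every
  basis vector occurring in \<open>x\<close> is \<open>\<alpha>(T)\<close>, so only basis vectors from the root space occur.\<close>

lemma root_space_eq_span:
  assumes b: "basis_of scale UNIV b"
    and lin: "\<And>T. T \<in> \<T> \<Longrightarrow> Vector_Spaces.linear scale scale T"
    and eig: "\<And>T e. T \<in> \<T> \<Longrightarrow> e \<in> b \<Longrightarrow> \<exists>r. T e = scale r e"
  shows "root_space scale \<T> \<alpha> = span (b \<inter> root_space scale \<T> \<alpha>)"
proof
  have ind: "independent b" and sp: "\<And>x. x \<in> span b"
    using b by (auto simp: basis_of_def)
  show "span (b \<inter> root_space scale \<T> \<alpha>) \<subseteq> root_space scale \<T> \<alpha>"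
    by (intro span_minimal subspace_root_space lin) auto
  show "root_space scale \<T> \<alpha> \<subseteq> span (b \<inter> root_space scale \<T> \<alpha>)"
  proof
    fix x assume x: "x \<in> root_space scale \<T> \<alpha>"
    define S where "S = {e. representation b x e \<noteq> 0}"
    have fin: "finite S" and Sb: "S \<subseteq> b"
      by (auto simp: S_def finite_representation dest: representation_ne_zero)
    have xsum: "(\<Sum>e\<in>S. scale (representation b x e) e) = x"
      unfolding S_def by (rule sum_nonzero_representation_eq[OF ind sp])
    have "S \<subseteq> root_space scale \<T> \<alpha>"
    proof
      fix e assume e: "e \<in> S"
      have "T e = scale (\<alpha> T) e" if T: "T \<in> \<T>" for T
      proof -
        interpret T: Vector_Spaces.linear scale scale T by (rule lin[OF T])
        obtain r where r: "\<And>e. e \<in> b \<Longrightarrow> T e = scale (r e) e" using eig[OF T] by metis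
        have "(\<Sum>e\<in>S. scale (representation b x e * (r e - \<alpha> T)) e)
            = (\<Sum>e\<in>S. scale (representation b x e) (T e))
              - (\<Sum>e\<in>S. scale (\<alpha> T) (scale (representation b x e) e))"
          unfolding sum_subtractf[symmetric]
        proof (rule sum.cong[OF refl])
          fix e assume "e \<in> S"
          then show "scale (representation b x e * (r e - \<alpha> T)) e
            = scale (representation b x e) (T e) - scale (\<alpha> T) (scale (representation b x e) e)"
            using r[of e] Sb by (auto simp: algebra_simps)
        qed
        also have "\<dots> = T x - scale (\<alpha> T) x"
          by (simp only: T.scale[symmetric] T.sum[symmetric] scale_sum_right[symmetric] xsum)
        also have "\<dots> = 0" using x T by (simp add: root_space_def)
        finally have "representation b x e * (r e - \<alpha> T) = 0"
          by (rule independentD[OF ind fin Sb _ e])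
        then show ?thesis using e r[of e] Sb by (auto simp: S_def)
      qed
      then show "e \<in> root_space scale \<T> \<alpha>" by (simp add: root_space_def)
    qed
    then have "(\<Sum>e\<in>S. scale (representation b x e) e) \<in> span (b \<inter> root_space scale \<T> \<alpha>)"
      using Sb by (intro span_sum span_scale span_base) auto
    then show "x \<in> span (b \<inter> root_space scale \<T> \<alpha>)" by (simp only: xsum)
  qed
qed

text \<open>A decomposition of \<open>x\<close> is obtained by grouping the terms of its basis expansion; it is
  the only one because each coordinate of \<open>x\<close> is contributed by exactly one component.\<close>

lemma direct_sum_of_basis_partition:
  assumes b: "basis_of scale UNIV (\<Union>a\<in>A. E a)" and disj: "disjoint_family_on E A"
  shows "is_direct_sum scale A (\<lambda>a. span (E a))"
proof -
  define b where "b = (\<Union>a\<in>A. E a)"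
  have ind: "independent b" and sp: "\<And>x. x \<in> span b"
    using b by (auto simp: basis_of_def b_def)
  define D where "D x f \<longleftrightarrow> (\<forall>a\<in>A. f a \<in> span (E a)) \<and> (\<forall>a. a \<notin> A \<longrightarrow> f a = 0) \<and>
      finite {a. f a \<noteq> 0} \<and> x = (\<Sum>a | f a \<noteq> 0. f a)" for x f
  have outside: "representation b y e = 0"
    if "y \<in> span (E a)" "a \<in> A" "e \<notin> E a" for y a e
  proof -
    have "representation b y = representation (E a) y"
      using that by (intro representation_extend ind) (auto simp: b_def)
    then show ?thesis using representation_ne_zero that(3) by metis
  qed
  have coord: "representation b x e = representation b (f a) e"
    if f: "D x f" and a: "a \<in> A" "e \<in> E a" for x f a e
  proof -
    have other: "representation b (f c) e = 0" if "c \<noteq> a" for c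
    proof (cases "c \<in> A")
      case True
      then have "e \<notin> E c" using disj a \<open>c \<noteq> a\<close> by (auto simp: disjoint_family_on_def)
      then show ?thesis using f True outside by (auto simp: D_def)
    next
      case False
      then show ?thesis using f by (simp add: D_def representation_zero)
    qed
    have "representation b x e = representation b (\<Sum>c | f c \<noteq> 0. f c) e"
      using f by (simp add: D_def)
    also have "\<dots> = (\<Sum>c | f c \<noteq> 0. representation b (f c) e)"
      by (simp add: representation_sum[OF ind sp])
    also have "\<dots> = (\<Sum>c\<in>insert a {c. f c \<noteq> 0}. representation b (f c) e)"
      using f by (intro sum.mono_neutral_left) (auto simp: D_def representation_zero)
    also have "\<dots> = (\<Sum>c\<in>{a}. representation b (f c) e)"
      using f other by (intro sum.mono_neutral_right) (auto simp: D_def)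
    finally show ?thesis by simp
  qed
  have "f = g" if f: "D x f" and g: "D x g" for x f g
  proof
    fix a
    show "f a = g a"
    proof (cases "a \<in> A")
      case True
      have "representation b (f a) = representation b (g a)"
      proof
        fix e
        show "representation b (f a) e = representation b (g a) e"
        proof (cases "e \<in> E a")
          case in_E: True
          show ?thesis using coord[OF f True in_E] coord[OF g True in_E] by simp
        next
          case False
          have "f a \<in> span (E a)" "g a \<in> span (E a)" using f g True by (auto simp: D_def)
          then show ?thesis using outside[OF _ True False] by simp
        qed
      qed
      then show ?thesis by (metis sum_nonzero_representation_eq[OF ind sp])
    next
      case False
      then show ?thesis using f g by (simp add: D_def)
    qed
  qed
  moreover have "\<exists>f. D x f" for x
  proof -
    define S where "S = {e. representation b x e \<noteq> 0}"
    have fin: "finite S" and Sb: "S \<subseteq> b"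
      by (auto simp: S_def finite_representation dest: representation_ne_zero)
    obtain p where p: "\<And>e. e \<in> S \<Longrightarrow> p e \<in> A \<and> e \<in> E (p e)"
      using Sb unfolding b_def by (metis UN_E subsetD)
    define f where "f a = (\<Sum>e | e \<in> S \<and> p e = a. scale (representation b x e) e)" for a
    have null: "f a = 0" if "a \<notin> p ` S" for a
      unfolding f_def using that by (intro sum.neutral) auto
    have "(\<Sum>a | f a \<noteq> 0. f a) = (\<Sum>a\<in>p ` S. f a)"
      using fin null by (intro sum.mono_neutral_left) auto
    also have "\<dots> = (\<Sum>e\<in>S. scale (representation b x e) e)"
      unfolding f_def using fin by (intro sum.group) auto
    also have "\<dots> = x"
      unfolding S_def by (rule sum_nonzero_representation_eq[OF ind sp])
    finally have "x = (\<Sum>a | f a \<noteq> 0. f a)" by simp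
    moreover have "finite {a. f a \<noteq> 0}"
      by (rule finite_subset[OF _ finite_imageI[OF fin, of p]]) (use null in auto)
    moreover have "f a \<in> span (E a)" for a
      unfolding f_def using p by (intro span_sum span_scale span_base) auto
    moreover have "f a = 0" if "a \<notin> A" for a
      using that p by (intro null) auto
    ultimately show ?thesis unfolding D_def by blast
  qed
  ultimately have "\<exists>!f. D x f" for x by blast
  then show ?thesis by (simp add: is_direct_sum_def D_def)
qed

section \<open>Orthogonal bases diagonalize the associated maps\<close>

lemma orthogonal_basis_eigenvector:
  assumes b: "basis_of scale UNIV b"
    and B\<^sub>0: "inner_product scale B\<^sub>0" "nondegenerate B\<^sub>0"
    and orth: "\<And>u v. u \<in> b \<Longrightarrow> v \<in> b \<Longrightarrow> u \<noteq> v \<Longrightarrow> B\<^sub>0 u v = 0 \<and> B u v = 0"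
    and T: "\<And>x y. B x y = B\<^sub>0 (T x) y"
    and e: "e \<in> b"
  shows "\<exists>r. T e = scale r e"
proof -
  have ind: "independent b" and sp: "\<And>x. x \<in> span b"
    using b by (auto simp: basis_of_def)
  interpret l0: Vector_Spaces.linear scale "(*)" "\<lambda>x. B\<^sub>0 x y" for y
    using B\<^sub>0 by (simp add: inner_product_def)
  interpret r0: Vector_Spaces.linear scale "(*)" "B\<^sub>0 x" for x
    using B\<^sub>0 by (simp add: inner_product_def)
  have on_basis: "u = w" if "\<And>f. f \<in> b \<Longrightarrow> B\<^sub>0 u f = B\<^sub>0 w f" for u w
  proof (rule nondegenerate_cancel[OF B\<^sub>0])
    show "B\<^sub>0 u y = B\<^sub>0 w y" for y
      using sp[of y]
    proof (induction rule: span_induct_alt)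
      case base
      show ?case by (simp only: r0.zero)
    next
      case (step c f y)
      then show ?case by (simp only: r0.add r0.scale that)
    qed
  qed
  have "e \<noteq> 0" using e ind dependent_zero by blast
  have ee: "B\<^sub>0 e e \<noteq> 0"
  proof
    assume "B\<^sub>0 e e = 0"
    then have "B\<^sub>0 e f = B\<^sub>0 0 f" if "f \<in> b" for f
      using orth[OF e that] by (cases "f = e") (auto simp: l0.zero)
    then show False using on_basis \<open>e \<noteq> 0\<close> by blast
  qed
  have "T e = scale (B e e / B\<^sub>0 e e) e"
  proof (rule on_basis)
    show "B\<^sub>0 (T e) f = B\<^sub>0 (scale (B e e / B\<^sub>0 e e) e) f" if "f \<in> b" for f
      using orth[OF e that] ee by (cases "f = e") (auto simp: T[symmetric] l0.scale)
  qed
  then show ?thesis ..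
qed

end

section \<open>The root space decomposition\<close>

theorem corollary2:
  fixes scale :: "'k::field \<Rightarrow> 'v::ab_group_add \<Rightarrow> 'v"
    and I :: "'i set" and i\<^sub>0 :: 'i
    and B :: "'i \<Rightarrow> 'v \<Rightarrow> 'v \<Rightarrow> 'k"
    and \<T> :: "('v \<Rightarrow> 'v) set"
  assumes "vector_space scale"
    and "\<forall>i\<in>insert i\<^sub>0 I. inner_product scale (B i)"
    and "nondegenerate (B i\<^sub>0)"
    and "\<forall>i\<in>insert i\<^sub>0 I.
           partially_continuous (form_topology (B i\<^sub>0)) (discrete_topology UNIV) (B i)"
    and "\<T> = {associated_map scale (B i\<^sub>0) (B i) | i. i \<in> I}"
    and "simultaneously_orthogonalizable scale (insert i\<^sub>0 I) B"
  shows "is_direct_sum scale (roots scale \<T>) (root_space scale \<T>) \<and>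
    (\<forall>i\<in>insert i\<^sub>0 I. \<forall>\<alpha>\<in>roots scale \<T>. \<forall>\<beta>\<in>roots scale \<T>. \<alpha> \<noteq> \<beta> \<longrightarrow>
       (\<forall>x\<in>root_space scale \<T> \<alpha>. \<forall>y\<in>root_space scale \<T> \<beta>. B i x y = 0)) \<and>
    (\<exists>c. (\<forall>i\<in>insert i\<^sub>0 I. \<forall>\<alpha>\<in>roots scale \<T>.
            \<forall>x\<in>root_space scale \<T> \<alpha>. \<forall>y\<in>root_space scale \<T> \<alpha>. B i x y = c i \<alpha> * B i\<^sub>0 x y) \<and>
         (\<exists>E. (\<forall>\<alpha>\<in>roots scale \<T>. basis_of scale (root_space scale \<T> \<alpha>) (E \<alpha>)) \<and>
              basis_of scale UNIV (\<Union>\<alpha>\<in>roots scale \<T>. E \<alpha>) \<and>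
              (\<forall>i\<in>insert i\<^sub>0 I.
                 block_diagonal (roots scale \<T>) E
                   (gram_matrix (\<Union>\<alpha>\<in>roots scale \<T>. E \<alpha>) (B i))
                   (\<lambda>\<alpha>. gram_matrix (E \<alpha>) (\<lambda>x y. c i \<alpha> * B i\<^sub>0 x y)))))"
proof -
  interpret vector_space scale by fact
  let ?R = "roots scale \<T>"
  let ?V = "root_space scale \<T>"
  let ?T = "\<lambda>i. associated_map scale (B i\<^sub>0) (B i)"
  have ip: "inner_product scale (B i)" if "i \<in> insert i\<^sub>0 I" for i
    using assms(2) that by blast
  have lin: "Vector_Spaces.linear scale scale (?T i)" and T: "B i x y = B i\<^sub>0 (?T i x) y"
    if "i \<in> I" for i x y
    using associated_map_properties[of scale "B i\<^sub>0" "B i"] assms(2-4) that by auto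
  have linT: "Vector_Spaces.linear scale scale S" if "S \<in> \<T>" for S
    using that lin assms(5) by auto
  interpret l0: Vector_Spaces.linear scale "(*)" "\<lambda>x. B i\<^sub>0 x y" for y
    using ip[of i\<^sub>0] by (simp add: inner_product_def)

  obtain b where b: "basis_of scale UNIV b"
    and orth: "\<And>i u v. i \<in> insert i\<^sub>0 I \<Longrightarrow> u \<in> b \<Longrightarrow> v \<in> b \<Longrightarrow> u \<noteq> v \<Longrightarrow> B i u v = 0"
    using assms(6) unfolding simultaneously_orthogonalizable_def by blast
  have nz: "e \<noteq> 0" if "e \<in> b" for e
    using that b dependent_zero by (auto simp: basis_of_def)
  have eig: "\<exists>r. S e = scale r e" if S: "S \<in> \<T>" and e: "e \<in> b" for S e
  proof -
    obtain i where i: "i \<in> I" "S = ?T i" using S assms(5) by blast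
    show ?thesis unfolding i(2)
      by (rule orthogonal_basis_eigenvector[OF b ip assms(3) _ T[OF i(1)] e])
        (use orth i(1) in auto)
  qed

  define E where "E \<alpha> = b \<inter> ?V \<alpha>" for \<alpha>
  have VE: "?V \<alpha> = span (E \<alpha>)" for \<alpha>
    unfolding E_def by (rule root_space_eq_span[OF b]) (use linT eig in blast)+
  have UE: "(\<Union>\<alpha>\<in>?R. E \<alpha>) = b"
    using common_eigenvector_in_root_space[of _ \<T>] nz eig by (fastforce simp: E_def)
  have disj: "disjoint_family_on E ?R"
    using root_eq_of_common_eigenvector nz by (fastforce simp: disjoint_family_on_def E_def)
  have basisE: "basis_of scale (?V \<alpha>) (E \<alpha>)" for \<alpha>
    unfolding basis_of_def
  proof
    have "E \<alpha> \<subseteq> b" by (simp add: E_def)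
    then show "independent (E \<alpha>)" using b independent_mono by (auto simp: basis_of_def)
    show "span (E \<alpha>) = ?V \<alpha>" by (rule VE[symmetric])
  qed
  have ds: "is_direct_sum scale ?R ?V"
  proof -
    have "?V = (\<lambda>\<alpha>. span (E \<alpha>))" by (rule ext) (rule VE)
    then show ?thesis using direct_sum_of_basis_partition[of E ?R] b disj by (simp only: UE)
  qed

  \<comment> \<open>If \<open>i\<^sub>0 \<notin> I\<close>, then no root provides a factor for \<open>\<langle>\<cdot>,\<cdot>\<rangle>\<^sub>0\<close> itself; it is 1.\<close>
  define c where "c i \<alpha> = (if i \<in> I then \<alpha> (?T i) else 1)"
    for i and \<alpha> :: "('v \<Rightarrow> 'v) \<Rightarrow> 'k"
  have factor: "B i x y = c i \<alpha> * B i\<^sub>0 x y"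
    if i: "i \<in> insert i\<^sub>0 I" and x: "x \<in> ?V \<alpha>" for i \<alpha> x y
  proof (cases "i \<in> I")
    case True
    then have "?T i x = scale (\<alpha> (?T i)) x" using x assms(5) by (auto simp: root_space_def)
    then show ?thesis using T[OF True, of x y] True by (simp add: c_def l0.scale)
  next
    case False
    then show ?thesis using i by (simp add: c_def)
  qed
  have perp: "B i x y = 0"
    if i: "i \<in> insert i\<^sub>0 I" and R: "\<alpha> \<in> ?R" "\<beta> \<in> ?R" "\<alpha> \<noteq> \<beta>"
      and xy: "x \<in> ?V \<alpha>" "y \<in> ?V \<beta>" for i \<alpha> \<beta> x y
  proof -
    have "\<exists>S\<in>\<T>. \<alpha> S \<noteq> \<beta> S"
    proof (rule ccontr)
      assume "\<not> ?thesis"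
      then have "\<alpha> = \<beta>" using R by (intro PiE_ext[of \<alpha> \<T> _ \<beta>]) (auto simp: roots_def)
      then show False using R by blast
    qed
    then obtain j where j: "j \<in> I" "\<alpha> (?T j) \<noteq> \<beta> (?T j)" using assms(5) by blast
    \<comment> \<open>Moving \<open>T\<^sub>j\<close> across the form replaces one eigenvalue by the other.\<close>
    have "\<alpha> (?T j) * B i\<^sub>0 x y = B j x y"
      using factor[of j x \<alpha> y] xy j(1) by (simp add: c_def)
    also have "\<dots> = B j y x"
      using ip[of j] j(1) inner_product_commute by blast
    also have "\<dots> = \<beta> (?T j) * B i\<^sub>0 y x"
      using factor[of j y \<beta> x] xy j(1) by (simp add: c_def)
    also have "B i\<^sub>0 y x = B i\<^sub>0 x y"
      using ip[of i\<^sub>0] inner_product_commute by blast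
    finally have "B i\<^sub>0 x y = 0" using j(2) by simp
    then show ?thesis using factor[OF i xy(1), of y] by simp
  qed
  have block: "block_diagonal ?R E (gram_matrix (\<Union>\<alpha>\<in>?R. E \<alpha>) (B i))
      (\<lambda>\<alpha>. gram_matrix (E \<alpha>) (\<lambda>x y. c i \<alpha> * B i\<^sub>0 x y))" if i: "i \<in> insert i\<^sub>0 I" for i
    unfolding block_diagonal_def
  proof (intro conjI ballI disj)
    fix \<alpha> \<beta> u v assume R: "\<alpha> \<in> ?R" "\<beta> \<in> ?R" and uv: "u \<in> E \<alpha>" "v \<in> E \<beta>"
    then have V: "u \<in> ?V \<alpha>" "v \<in> ?V \<beta>" by (auto simp: E_def)
    have "gram_matrix (\<Union>\<alpha>\<in>?R. E \<alpha>) (B i) u v = B i u v"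
      unfolding gram_matrix_def UE using uv by (simp add: E_def)
    also have "\<dots> = (if \<alpha> = \<beta> then gram_matrix (E \<alpha>) (\<lambda>x y. c i \<alpha> * B i\<^sub>0 x y) u v else 0)"
      using factor[OF i V(1), of v] perp[OF i R _ V] uv
      by (cases "\<alpha> = \<beta>") (auto simp: gram_matrix_def)
    finally show "gram_matrix (\<Union>\<alpha>\<in>?R. E \<alpha>) (B i) u v
      = (if \<alpha> = \<beta> then gram_matrix (E \<alpha>) (\<lambda>x y. c i \<alpha> * B i\<^sub>0 x y) u v else 0)" .
  qed
  show ?thesis
  proof (intro conjI exI[of _ c] exI[of _ E] ballI allI impI)
    show "basis_of scale UNIV (\<Union>\<alpha>\<in>?R. E \<alpha>)" using b by (simp only: UE)
  qed (rule ds, (rule perp; assumption), (rule factor; assumption), rule basisE, (rule block; assumption))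
qed

end
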